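(* Let $X=\{x\in\mathbb{R}^n : Ax=b,\ x\geq 0\}$ with $A\in\mathbb{Q}^{m\times n}$, $b\in\mathbb{Q}^m$, and let $c_1,c_2,d_1\in\mathbb{Q}^n$ be (row) objective vectors. Let $x^*\in X$. The following are equivalent: (a) there exist non-negative normalized weights $w^*=(w_1^*,w_2^*,w_3^* )$, i.e. $w^*_i\ge 0$ and $w_1^*+w_2^*+w_3^*=1$, with $w_1^*>0$, such that $x^*$ is optimal for $\mathrm{WS}(\mathrm{TOLP},w^* )$; (b) there exist a parameter $\lambda\geq 0$ and non-negative normalized weights $w=(w_1,w_2)$, i.e. $w_i\ge 0$ and $w_1+w_2=1$, with $w_1>0$, such that $x^*$ is optimal for $\mathrm{WS}(\mathrm{PBLP}^1(\lambda),w)$.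
   Context: $\mathrm{PBLP}^1$ is the parametric biobjective linear program $\min_{x\in X}\,(c_1x+\lambda d_1x,\ c_2x)^\top$ with parameter $\lambda\ge 0$; for fixed $\lambda$ it is denoted $\mathrm{PBLP}^1(\lambda)$. The associated triobjective linear program TOLP is $\min_{x\in X}(c_1x,c_2x,d_1x)^\top$. $\mathrm{WS}(\mathrm{PBLP}^1(\lambda),w)$ is the linear program $\min_{x\in X}\ w_1(c_1x+\lambda d_1x)+w_2c_2x$, and $\mathrm{WS}(\mathrm{TOLP},w^* )$ is the linear program $\min_{x\in X}\ w_1^*c_1x+w_2^*c_2x+w_3^*d_1x$. *)

theory Defs
  imports "HOL-Analysis.Analysis"
begin

definition feasible_set :: "real^'n^'m \<Rightarrow> real^'m \<Rightarrow> (real^'n) set" where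
  "feasible_set A b = {x. A *v x = b \<and> (\<forall>j. 0 \<le> x $ j)}"

definition tolp_objective ::
  "real^'n \<Rightarrow> real^'n \<Rightarrow> real^'n \<Rightarrow> real^'n \<Rightarrow> real^3" where
  "tolp_objective c1 c2 d1 x = vector [c1 \<bullet> x, c2 \<bullet> x, d1 \<bullet> x]"

definition pblp1_objective ::
  "real^'n \<Rightarrow> real^'n \<Rightarrow> real^'n \<Rightarrow> real \<Rightarrow> real^'n \<Rightarrow> real^2" where
  "pblp1_objective c1 c2 d1 lam x = vector [c1 \<bullet> x + lam * (d1 \<bullet> x), c2 \<bullet> x]"

definition normalized_weights :: "real^'k \<Rightarrow> bool" where
  "normalized_weights w \<longleftrightarrow> (\<forall>i. 0 \<le> w $ i) \<and> (\<Sum>i\<in>UNIV. w $ i) = 1"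

definition ws_optimal ::
  "(real^'n) set \<Rightarrow> (real^'n \<Rightarrow> real^'k) \<Rightarrow> real^'k \<Rightarrow> real^'n \<Rightarrow> bool" where
  "ws_optimal X f w x \<longleftrightarrow> is_arg_min (\<lambda>y. \<Sum>i\<in>UNIV. w $ i * f y $ i) (\<lambda>y. y \<in> X) x"

end

theory Submission
  imports Defs
begin

text \<open>
  Whenever \<open>w\<^sub>3\<^sup>* = w\<^sub>1\<^sup>* \<lambda>\<close>, the weighted sum of the three objectives with weights \<open>w\<^sup>*\<close> is the
  weighted sum of the parametric objectives with weights \<open>(w\<^sub>1\<^sup>*, w\<^sub>2\<^sup>*)\<close>. As \<open>w\<^sub>1 > 0\<close>, either of \<open>\<lambda>\<close> and
  \<open>w\<^sub>3\<^sup>*\<close> can be recovered from the other, and normalizing the weights rescales the objective by a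
  positive factor, which does not change the optimal solutions.
\<close>

text \<open>Only the scalarized values matter, so \<open>f\<close> and \<open>g\<close> may have
  different numbers of components; this lets the lemma pass between three and two
  objectives.\<close>

lemma ws_optimal_scale:
  assumes "ws_optimal X f w x" and "0 < r"
    and "\<And>y. (\<Sum>i\<in>UNIV. v $ i * g y $ i) = r * (\<Sum>i\<in>UNIV. w $ i * f y $ i)"
  shows "ws_optimal X g v x"
  using assms by (simp add: ws_optimal_def is_arg_min_def)

lemma weighted_sum_tolp_objective:
  "(\<Sum>i\<in>UNIV. w $ i * tolp_objective c1 c2 d1 x $ i)
     = w $ 1 * (c1 \<bullet> x) + w $ 2 * (c2 \<bullet> x) + w $ 3 * (d1 \<bullet> x)"
  by (simp add: tolp_objective_def sum_3)

lemma weighted_sum_pblp1_objective: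
  "(\<Sum>i\<in>UNIV. w $ i * pblp1_objective c1 c2 d1 lam x $ i)
     = w $ 1 * (c1 \<bullet> x + lam * (d1 \<bullet> x)) + w $ 2 * (c2 \<bullet> x)"
  by (simp add: pblp1_objective_def sum_2)

lemma tolp_optimal_imp_pblp1_optimal:
  fixes w :: "real^3"
  assumes w: "normalized_weights w" "0 < w $ 1"
    and opt: "ws_optimal X (tolp_objective c1 c2 d1) w x"
  shows "\<exists>(lam :: real) (v :: real^2). 0 \<le> lam \<and> normalized_weights v \<and> 0 < v $ 1 \<and>
           ws_optimal X (pblp1_objective c1 c2 d1 lam) v x"
proof -
  \<comment> \<open>Dropping the third weight leaves total mass \<open>s\<close>, positive because
    \<open>w $ 1\<close> is; \<open>lam\<close> is chosen so that
    \<open>v $ 1 * lam = w $ 3 / s\<close>.\<close>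
  define s where "s = w $ 1 + w $ 2"
  define lam where "lam = w $ 3 / w $ 1"
  define v :: "real^2" where "v = vector [w $ 1 / s, w $ 2 / s]"
  have nonneg: "0 \<le> w $ i" for i
    using w by (simp add: normalized_weights_def)
  have s: "0 < s"
    using w(2) nonneg[of 2] by (simp add: s_def)
  have "0 \<le> lam"
    using nonneg by (simp add: lam_def)
  moreover have "normalized_weights v"
    using s nonneg
    by (simp add: normalized_weights_def v_def forall_2 sum_2 add_divide_distrib[symmetric])
       (simp add: s_def)
  moreover have "0 < v $ 1"
    using s w(2) by (simp add: v_def)
  moreover have "ws_optimal X (pblp1_objective c1 c2 d1 lam) v x"
    using opt
  proof (rule ws_optimal_scale[where r = "1 / s"])
    show "0 < 1 / s"
      using s by simp
    show "(\<Sum>i\<in>UNIV. v $ i * pblp1_objective c1 c2 d1 lam y $ i)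
            = 1 / s * (\<Sum>i\<in>UNIV. w $ i * tolp_objective c1 c2 d1 y $ i)" for y
      unfolding weighted_sum_tolp_objective weighted_sum_pblp1_objective
      \<comment> \<open>Positivity of \<open>w $ 1\<close> cancels the denominator of
        \<open>lam\<close>.\<close>
      using s w(2) by (simp add: v_def lam_def field_simps)
  qed
  ultimately show ?thesis
    by blast
qed

lemma pblp1_optimal_imp_tolp_optimal:
  fixes v :: "real^2"
  assumes lam: "0 \<le> lam" and v: "normalized_weights v" "0 < v $ 1"
    and opt: "ws_optimal X (pblp1_objective c1 c2 d1 lam) v x"
  shows "\<exists>w :: real^3. normalized_weights w \<and> 0 < w $ 1 \<and>
           ws_optimal X (tolp_objective c1 c2 d1) w x"
proof -
  \<comment> \<open>Expanding the parametric objective gives \<open>d1\<close> the coefficient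
    \<open>lam * v $ 1\<close>; \<open>t\<close> is the total of the three raw weights.\<close>
  define t where "t = v $ 1 + v $ 2 + lam * v $ 1"
  define w :: "real^3" where "w = vector [v $ 1 / t, v $ 2 / t, lam * v $ 1 / t]"
  have nonneg: "0 \<le> v $ i" for i
    using v by (simp add: normalized_weights_def)
  have t: "0 < t"
    using v(2) nonneg[of 2] lam by (simp add: t_def add_pos_nonneg)
  have "normalized_weights w"
    \<comment> \<open>\<open>t\<close> stays folded while the fractions are merged, so that its
      positivity applies; unfolding it then closes the sum.\<close>
    using t nonneg lam
    by (simp add: normalized_weights_def w_def forall_3 sum_3 add_divide_distrib[symmetric])
       (simp add: t_def)
  moreover have "0 < w $ 1"
    using t v(2) by (simp add: w_def)
  moreover have "ws_optimal X (tolp_objective c1 c2 d1) w x"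
    using opt
  proof (rule ws_optimal_scale[where r = "1 / t"])
    show "0 < 1 / t"
      using t by simp
    show "(\<Sum>i\<in>UNIV. w $ i * tolp_objective c1 c2 d1 y $ i)
            = 1 / t * (\<Sum>i\<in>UNIV. v $ i * pblp1_objective c1 c2 d1 lam y $ i)" for y
      unfolding weighted_sum_tolp_objective weighted_sum_pblp1_objective
      using t by (simp add: w_def field_simps)
  qed
  ultimately show ?thesis
    by blast
qed

theorem theorem12:
  fixes A :: "real^'n^'m" and b :: "real^'m"
    and c1 c2 d1 x_opt :: "real^'n"
  assumes "\<forall>i j. A $ i $ j \<in> \<rat>"
    and "\<forall>i. b $ i \<in> \<rat>"
    and "\<forall>j. c1 $ j \<in> \<rat>"
    and "\<forall>j. c2 $ j \<in> \<rat>"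
    and "\<forall>j. d1 $ j \<in> \<rat>"
    and "x_opt \<in> feasible_set A b"
  shows "(\<exists>w :: real^3. normalized_weights w \<and> 0 < w $ 1 \<and>
            ws_optimal (feasible_set A b) (tolp_objective c1 c2 d1) w x_opt)
         \<longleftrightarrow>
         (\<exists>(lam :: real) (w :: real^2). 0 \<le> lam \<and> normalized_weights w \<and> 0 < w $ 1 \<and>
            ws_optimal (feasible_set A b) (pblp1_objective c1 c2 d1 lam) w x_opt)"
  using tolp_optimal_imp_pblp1_optimal pblp1_optimal_imp_tolp_optimal by blast

end
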